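(* Let $n>4$ be an even integer and let $P=(A_1,\dots,A_n)$ be a cyclic $n$-gon (distinct vertices on a circle) with vertices ordered anticlockwise. Then \[\sum_{m=1}^{n}(-1)^{m+1}x(m)S(m)=0,\] where \[ x(m)=\begin{cases} x_{12}\,x_{34}^{c}\displaystyle\prod_{\substack{l=m\\ l\text{ even}}}^{n-2}x_{l,l+1}^{\frac{l-2}{2}}\prod_{\substack{l=5\\ l\text{ odd}}}^{m-1}x_{l,l+1}^{\frac{l-3}{2}}, & m \text{ even};\\[2ex] x_{12}^{a}\displaystyle\prod_{\substack{l=m-1\\ l\text{ even}}}^{n-2}x_{l,l+1}^{\frac{l-2}{2}}\prod_{\substack{l=5\\ l\text{ odd}}}^{m}x_{l,l+1}^{\frac{l-3}{2}}, & m\text{ odd},\ n=6;\\[2ex] x_{12}^{a}x_{34}^{b}\,x_{m-2,m-1}^{\frac{m-5}{2}}\,x_{m,m+1}^{\frac{m-3}{2}}\displaystyle\prod_{\substack{l=m-1\\ l\text{ even}}}^{n-2}x_{l,l+1}^{\frac{l-2}{2}}\prod_{\substack{l=5\\ l\text{ odd}}}^{m-4}x_{l,l+1}^{\frac{l-5}{2}}, & m\text{ odd},\ n>6; \end{cases} \] \[ S(m)=\left(\prod_{k=1}^{m-1}\Big(\prod_{\substack{l=k+1\\ l\text{ even}}}^{m-2}S_{k,l,l+1}\prod_{\substack{l=m+1\\ l\text{ odd}}}^{n-1}S_{k,l,l+1}\Big)\right)\left(\prod_{k=m}^{n-3}\prod_{\substack{l=k+2\\ l\text{ odd}}}^{n-1}S_{k+1,l,l+1}\right)\quad\text{for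 } m \text{ even}, \] \[ \begin{aligned} S(m)={}&S_{m-2,m-1,m+1}\left(\prod_{\substack{l=m+2\\ l\text{ odd}}}^{n-1}S_{m-1,l,l+1}S_{m-2,l,l+1}S_{m-3,l,l+1}\right)\left(\prod_{k=m}^{n-3}\prod_{\substack{l=k+2\\ l\text{ odd}}}^{n-1}S_{k+1,l,l+1}\right)\\ &\cdot\prod_{k=1}^{m-4}\left(\big(S_{k,k+1,k+2}S_{k,k+1,m-1}S_{k,k+1,m+1}\big)^{(k\bmod 2)}\prod_{\substack{l=k+2\\ l\text{ even}}}^{m-2}S_{k,l,l+1}\prod_{\substack{l=m+2\\ l\text{ odd}}}^{n-1}S_{k,l,l+1}\right)\quad\text{for } m\text{ odd}, \end{aligned} \] with $a=1$ if $m\in\{1,3\}$ and $a=0$ otherwise; $b=1$ if $m\in\{1,3,5\}$ and $b=0$ otherwise; $c=0$ if $n=6$ and $c=1$ if $n\ge 8$.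
   Context: For points $A_p=(x_p,y_p)$, $x_{pq}:=(x_q-x_p)^2+(y_q-y_p)^2$ is the squared distance between $A_p$ and $A_q$, and $S_{pqr}:=2[(x_q-x_p)(y_r-y_p)-(y_q-y_p)(x_r-x_p)]$ is four times the signed area of triangle $A_pA_qA_r$; these are entries of the polygonal Heronian frieze of $P$. Conventions: if some index is $\le 0$, then $S_{pqr}=1$ and $x_{pq}=1$; $x_{pq}^{e}=1$ whenever the exponent $e<0$; a product $\prod_{l=\alpha}^{\beta}$ with $\alpha>\beta$ (or with no index of the required parity in range) equals $1$; a subscript "$l$ even/odd" restricts the product to indices of that parity; $k \bmod 2\in\{0,1\}$. *)

theory Defs
  imports "HOL-Analysis.Analysis"
begin

(* Points A_p are given by a function A :: int => real * real; only indices 1..n matter. *)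

definition hx :: "(int \<Rightarrow> real \<times> real) \<Rightarrow> int \<Rightarrow> int \<Rightarrow> real" where
  "hx A p q = (if p \<le> 0 \<or> q \<le> 0 then 1 else
      (fst (A q) - fst (A p))^2 + (snd (A q) - snd (A p))^2)"

definition hS :: "(int \<Rightarrow> real \<times> real) \<Rightarrow> int \<Rightarrow> int \<Rightarrow> int \<Rightarrow> real" where
  "hS A p q r = (if p \<le> 0 \<or> q \<le> 0 \<or> r \<le> 0 then 1 else
      2 * ((fst (A q) - fst (A p)) * (snd (A r) - snd (A p))
         - (snd (A q) - snd (A p)) * (fst (A r) - fst (A p))))"

definition hxp :: "(int \<Rightarrow> real \<times> real) \<Rightarrow> int \<Rightarrow> int \<Rightarrow> int \<Rightarrow> real" where
  "hxp A p q e = (if e < 0 then 1 else hx A p q ^ nat e)"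

definition prod_even :: "(int \<Rightarrow> real) \<Rightarrow> int \<Rightarrow> int \<Rightarrow> real" where
  "prod_even f a b = (\<Prod>l\<in>{l. a \<le> l \<and> l \<le> b \<and> even l}. f l)"

definition prod_odd :: "(int \<Rightarrow> real) \<Rightarrow> int \<Rightarrow> int \<Rightarrow> real" where
  "prod_odd f a b = (\<Prod>l\<in>{l. a \<le> l \<and> l \<le> b \<and> odd l}. f l)"

definition cyclic_anticlockwise :: "int \<Rightarrow> (int \<Rightarrow> real \<times> real) \<Rightarrow> bool" where
  "cyclic_anticlockwise n A \<longleftrightarrow>
     (\<exists>c r \<theta>. r > 0 \<and>
        (\<forall>i\<in>{1..n}. A i = (fst c + r * cos (\<theta> i), snd c + r * sin (\<theta> i))) \<and>
        (\<forall>i\<in>{1..n-1}. \<theta> i < \<theta> (i+1)) \<and>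
        \<theta> n < \<theta> 1 + 2 * pi)"

definition xfac :: "int \<Rightarrow> (int \<Rightarrow> real \<times> real) \<Rightarrow> int \<Rightarrow> real" where
  "xfac n A m =
    (let a = (if m \<in> {1,3} then 1 else 0 :: int);
         b = (if m \<in> {1,3,5} then 1 else 0 :: int);
         c = (if n = 6 then 0 else 1 :: int) in
     if even m then
       hx A 1 2 * hxp A 3 4 c
       * prod_even (\<lambda>l. hxp A l (l+1) ((l-2) div 2)) m (n-2)
       * prod_odd (\<lambda>l. hxp A l (l+1) ((l-3) div 2)) 5 (m-1)
     else if n = 6 then
       hxp A 1 2 a
       * prod_even (\<lambda>l. hxp A l (l+1) ((l-2) div 2)) (m-1) (n-2)
       * prod_odd (\<lambda>l. hxp A l (l+1) ((l-3) div 2)) 5 m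
     else
       hxp A 1 2 a * hxp A 3 4 b
       * hxp A (m-2) (m-1) ((m-5) div 2) * hxp A m (m+1) ((m-3) div 2)
       * prod_even (\<lambda>l. hxp A l (l+1) ((l-2) div 2)) (m-1) (n-2)
       * prod_odd (\<lambda>l. hxp A l (l+1) ((l-5) div 2)) 5 (m-4))"

definition Sfac :: "int \<Rightarrow> (int \<Rightarrow> real \<times> real) \<Rightarrow> int \<Rightarrow> real" where
  "Sfac n A m =
    (if even m then
       (\<Prod>k\<in>{1..m-1}. prod_even (\<lambda>l. hS A k l (l+1)) (k+1) (m-2)
                      * prod_odd (\<lambda>l. hS A k l (l+1)) (m+1) (n-1))
       * (\<Prod>k\<in>{m..n-3}. prod_odd (\<lambda>l. hS A (k+1) l (l+1)) (k+2) (n-1))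
     else
       hS A (m-2) (m-1) (m+1)
       * prod_odd (\<lambda>l. hS A (m-1) l (l+1) * hS A (m-2) l (l+1) * hS A (m-3) l (l+1)) (m+2) (n-1)
       * (\<Prod>k\<in>{m..n-3}. prod_odd (\<lambda>l. hS A (k+1) l (l+1)) (k+2) (n-1))
       * (\<Prod>k\<in>{1..m-4}.
            (hS A k (k+1) (k+2) * hS A k (k+1) (m-1) * hS A k (k+1) (m+1)) ^ nat (k mod 2)
            * prod_even (\<lambda>l. hS A k l (l+1)) (k+2) (m-2)
            * prod_odd (\<lambda>l. hS A k l (l+1)) (m+2) (n-1)))"

end

theory Submission
  imports Defs
begin

text \<open>
  For vertices on a circle of radius \<open>r\<close> with central angles \<open>\<theta> i\<close>, put
  \<open>d p q = 2 r sin ((\<theta> q - \<theta> p) / 2)\<close>, the signed chord length. Then \<open>x\<^bsub>pq\<^esub> = (d p q)\<^sup>2\<close> and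
  \<open>S\<^bsub>pqs\<^esub> = d p q * d p s * d q s / r\<close>, so each summand is a monomial in the chords. Building up the
  vertex set without \<open>m\<close> by adding consecutive pairs \<open>{l, l+1}\<close> shows that \<open>x(m) S(m)\<close> is the product
  of all chords avoiding \<open>m\<close>, times a factor that does not depend on \<open>m\<close>. Up to a common factor the
  summand is therefore the inverse of \<open>\<Prod>p\<noteq>m. sin ((\<theta> m - \<theta> p) / 2)\<close>. With
  \<open>z p = exp (\<i> \<theta> p)\<close> and \<open>n = 2 (h + 1)\<close> this inverse is a constant multiple of
  \<open>z m ^ h / (\<Prod>p\<noteq>m. z m - z p)\<close>, and these terms sum to zero by Lagrange interpolation since
  \<open>h \<le> n - 2\<close>.
\<close>

section \<open>Lagrange sums\<close>

text \<open>The factor \<open>z m - z a\<close> cancels the node \<open>a\<close> from the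
  denominator if \<open>m \<noteq> a\<close> and kills the term \<open>m = a\<close>.\<close>

lemma lagrange_sum_drop_node:
  fixes z :: "'a \<Rightarrow> 'b::field"
  assumes "finite V" "inj_on z V" "a \<in> V"
  shows "(\<Sum>m\<in>V. z m ^ j * (z m - z a) / (\<Prod>p\<in>V-{m}. z m - z p))
      = (\<Sum>m\<in>V-{a}. z m ^ j / (\<Prod>p\<in>V-{a}-{m}. z m - z p))"
proof -
  have "z m ^ j * (z m - z a) / (\<Prod>p\<in>V-{m}. z m - z p)
      = z m ^ j / (\<Prod>p\<in>V-{a}-{m}. z m - z p)" if "m \<in> V - {a}" for m
  proof -
    have "(\<Prod>p\<in>V-{m}. z m - z p) = (z m - z a) * (\<Prod>p\<in>V-{m}-{a}. z m - z p)"
      using that assms by (intro prod.remove) auto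
    moreover have "V-{m}-{a} = V-{a}-{m}" by auto
    moreover have "z m - z a \<noteq> 0"
      using that assms by (auto dest: inj_onD)
    ultimately show ?thesis by simp
  qed
  then show ?thesis
    using assms by (subst sum.remove[of V a]) auto
qed

text \<open>Since \<open>z b - z a\<close> is the difference of \<open>z m - z a\<close> and
  \<open>z m - z b\<close>, multiplying by it turns the sum into a difference of the sums over
  \<open>V - {a}\<close> and \<open>V - {b}\<close>, which have the same value.\<close>

lemma lagrange_sum_const_eq_0:
  fixes z :: "'a \<Rightarrow> 'b::field"
  assumes "finite V" "inj_on z V" "1 < card V"
  shows "(\<Sum>m\<in>V. 1 / (\<Prod>p\<in>V-{m}. z m - z p)) = 0"
  using assms
proof (induction "card V" arbitrary: V rule: less_induct)
  case less
  let ?Q = "\<lambda>m. \<Prod>p\<in>V-{m}. z m - z p"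
  let ?T = "\<lambda>W. \<Sum>m\<in>W. 1 / (\<Prod>p\<in>W-{m}. z m - z p)"
  obtain a b where ab: "a \<in> V" "b \<in> V" "a \<noteq> b"
    using less.prems by (metis One_nat_def card_le_Suc0_iff_eq not_le)
  \<comment> \<open>This value depends only on the size of \<open>V\<close>: a single remaining node
    has an empty denominator product, and larger sets fall under the induction hypothesis.\<close>
  have T: "?T (V-{c}) = (if card V = 2 then 1 else 0)" if c: "c \<in> V" for c
  proof (cases "card V = 2")
    case True
    then have "card (V-{c}) = 1" using c less.prems by simp
    then obtain e where "V - {c} = {e}" by (auto simp: card_1_singleton_iff)
    then show ?thesis using True by simp
  next
    case False
    then have "?T (V-{c}) = 0"
      using c less.prems by (intro less.hyps) (auto intro: inj_on_subset simp: card_gt_0_iff)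
    then show ?thesis using False by simp
  qed
  have "(z b - z a) * ?T V = (\<Sum>m\<in>V. z m ^ 0 * (z m - z a) / ?Q m) - (\<Sum>m\<in>V. z m ^ 0 * (z m - z b) / ?Q m)"
    by (simp add: sum_distrib_left flip: sum_subtractf diff_divide_distrib)
  also have "\<dots> = ?T (V-{a}) - ?T (V-{b})"
    using lagrange_sum_drop_node[OF less.prems(1,2), of _ 0] ab by simp
  also have "\<dots> = 0" using T ab by simp
  finally show ?case
    using ab less.prems(2) by (auto dest: inj_onD)
qed

text \<open>In \<open>z m ^ Suc k = z m ^ k * (z m - z a) + z a * z m ^ k\<close> the first part
  loses one node along with one degree, so the degree bound survives the induction.\<close>

lemma lagrange_sum_power_eq_0:
  fixes z :: "'a \<Rightarrow> 'b::field"
  assumes "finite V" "inj_on z V" "Suc k < card V"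
  shows "(\<Sum>m\<in>V. z m ^ k / (\<Prod>p\<in>V-{m}. z m - z p)) = 0"
  using assms
proof (induction k arbitrary: V)
  case 0
  then show ?case using lagrange_sum_const_eq_0 by simp
next
  case (Suc k)
  let ?Q = "\<lambda>m. \<Prod>p\<in>V-{m}. z m - z p"
  obtain a where a: "a \<in> V"
    using Suc.prems by (metis card.empty ex_in_conv not_less0)
  have "(\<Sum>m\<in>V. z m ^ Suc k / ?Q m) = (\<Sum>m\<in>V. z m ^ k * (z m - z a) / ?Q m) + z a * (\<Sum>m\<in>V. z m ^ k / ?Q m)"
    by (simp add: sum_distrib_left algebra_simps flip: sum.distrib add_divide_distrib)
  also have "\<dots> = (\<Sum>m\<in>V-{a}. z m ^ k / (\<Prod>p\<in>V-{a}-{m}. z m - z p)) + z a * (\<Sum>m\<in>V. z m ^ k / ?Q m)"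
    using lagrange_sum_drop_node[OF Suc.prems(1,2) a] by simp
  also have "(\<Sum>m\<in>V-{a}. z m ^ k / (\<Prod>p\<in>V-{a}-{m}. z m - z p)) = 0"
    using Suc.prems a by (intro Suc.IH) (auto intro: inj_on_subset)
  also have "(\<Sum>m\<in>V. z m ^ k / ?Q m) = 0"
    using Suc.prems by (intro Suc.IH) auto
  finally show ?case by simp
qed

section \<open>Reciprocal products of sines\<close>

lemma sin_half_diff_exp:
  "complex_of_real (sin ((b - a) / 2))
   = ((exp (\<i> * b / 2))\<^sup>2 - (exp (\<i> * a / 2))\<^sup>2) / (2 * \<i> * exp (\<i> * b / 2) * exp (\<i> * a / 2))"
proof -
  have "complex_of_real (sin ((b - a) / 2)) = sin (complex_of_real b / 2 - complex_of_real a / 2)"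
    by (simp add: sin_of_real[symmetric] diff_divide_distrib)
  also have "\<dots> = (exp (\<i> * b / 2) / exp (\<i> * a / 2) - exp (\<i> * a / 2) / exp (\<i> * b / 2)) / (2 * \<i>)"
    unfolding sin_exp_eq by (simp add: algebra_simps flip: exp_diff)
  also have "\<dots> = ((exp (\<i> * b / 2))\<^sup>2 - (exp (\<i> * a / 2))\<^sup>2) / (2 * \<i> * exp (\<i> * b / 2) * exp (\<i> * a / 2))"
    by (simp add: field_simps power2_eq_square)
  finally show ?thesis .
qed

text \<open>In exponentials each product of sines collects the odd power
  \<open>e m ^ (2*h+1)\<close>. One copy of \<open>e m\<close> completes the product of
  \<open>e p\<close> over \<open>V\<close>, and the remaining even power is \<open>z m ^ h\<close>;
  this is where the parity of \<open>card V\<close> enters.\<close>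

lemma sum_inverse_prod_sin_eq_0:
  fixes \<theta> :: "'a \<Rightarrow> real"
  assumes "finite V" "V \<noteq> {}" "even (card V)"
    and nz: "\<And>p q. p \<in> V \<Longrightarrow> q \<in> V \<Longrightarrow> p \<noteq> q \<Longrightarrow> sin ((\<theta> q - \<theta> p) / 2) \<noteq> 0"
  shows "(\<Sum>m\<in>V. 1 / (\<Prod>p\<in>V-{m}. sin ((\<theta> m - \<theta> p) / 2))) = 0"
proof -
  define e where "e p = exp (\<i> * complex_of_real (\<theta> p) / 2)" for p
  define z where "z p = (e p)\<^sup>2" for p
  obtain h where h: "card V = 2 * Suc h"
    using assms(1-3) by (metis card_0_eq evenE mult_0_right not0_implies_Suc)
  have s: "complex_of_real (sin ((\<theta> q - \<theta> p) / 2)) = (z q - z p) / (2 * \<i> * e q * e p)" for p q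
    unfolding z_def e_def by (rule sin_half_diff_exp)
  have inj: "inj_on z V"
    \<comment> \<open>Equal values of \<open>z\<close> would make the numerator in \<open>s\<close>
      vanish, and with it the sine.\<close>
    using nz s by (intro inj_onI) (metis div_0 diff_self of_real_eq_0_iff)
  have summand: "complex_of_real (1 / (\<Prod>p\<in>V-{m}. sin ((\<theta> m - \<theta> p) / 2)))
      = ((2 * \<i>) ^ (2*h+1) * (\<Prod>p\<in>V. e p)) * (z m ^ h / (\<Prod>p\<in>V-{m}. z m - z p))" if "m \<in> V" for m
  proof -
    have c: "card (V-{m}) = 2 * h + 1" using h that assms(1) by simp
    have "complex_of_real (\<Prod>p\<in>V-{m}. sin ((\<theta> m - \<theta> p) / 2))
        = (\<Prod>p\<in>V-{m}. z m - z p) / ((2 * \<i>) ^ (2*h+1) * e m ^ (2*h+1) * (\<Prod>p\<in>V-{m}. e p))"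
      by (simp add: s prod_dividef prod.distrib c power_mult_distrib)
    also have "e m ^ (2*h+1) * (\<Prod>p\<in>V-{m}. e p) = z m ^ h * (\<Prod>p\<in>V. e p)"
      using that assms(1) by (subst prod.remove[of V m]) (auto simp: z_def power_mult)
    then have "(2 * \<i>) ^ (2*h+1) * e m ^ (2*h+1) * (\<Prod>p\<in>V-{m}. e p) = (2 * \<i>) ^ (2*h+1) * (z m ^ h * (\<Prod>p\<in>V. e p))"
      by (simp only: mult.assoc)
    finally show ?thesis by simp
  qed
  have "complex_of_real (\<Sum>m\<in>V. 1 / (\<Prod>p\<in>V-{m}. sin ((\<theta> m - \<theta> p) / 2)))
     = ((2 * \<i>) ^ (2*h+1) * (\<Prod>p\<in>V. e p)) * (\<Sum>m\<in>V. z m ^ h / (\<Prod>p\<in>V-{m}. z m - z p))"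
    unfolding of_real_sum sum_distrib_left by (rule sum.cong) (simp_all only: summand)
  also have "\<dots> = 0"
    using lagrange_sum_power_eq_0[OF assms(1) inj, of h] h by simp
  finally show ?thesis by (simp only: of_real_eq_0_iff)
qed

section \<open>Products of chords\<close>

text \<open>For \<open>d p q = x q - x p\<close> this is the Vandermonde product. The order of the
  indices fixes one orientation of each chord, which matters because \<open>d\<close> will be
  antisymmetric.\<close>

definition chordprod :: "('a::linorder \<Rightarrow> 'a \<Rightarrow> 'b::comm_ring_1) \<Rightarrow> 'a set \<Rightarrow> 'b" where
  "chordprod d V = (\<Prod>q\<in>V. \<Prod>p\<in>{p\<in>V. p < q}. d p q)"

lemma chordprod_empty [simp]: "chordprod d {} = 1"
  by (simp add: chordprod_def)

lemma chordprod_insert_max: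
  assumes "finite V" "\<And>p. p \<in> V \<Longrightarrow> p < q"
  shows "chordprod d (insert q V) = chordprod d V * (\<Prod>p\<in>V. d p q)"
proof -
  have "q \<notin> V" using assms by auto
  moreover have "{p \<in> insert q V. p < q} = V" using assms by auto
  moreover have "{p \<in> insert q V. p < x} = {p \<in> V. p < x}" if "x \<in> V" for x
    using assms(2)[OF that] by auto
  ultimately show ?thesis
    using assms(1) unfolding chordprod_def by (simp add: mult.commute)
qed

lemma chordprod_singleton [simp]: "chordprod d {q} = 1"
  using chordprod_insert_max[of "{}" q d] by simp

text \<open>A chord at \<open>m\<close> is counted at \<open>m\<close> if its other end is earlier,
  and at that other end if it is later.\<close>

lemma chordprod_remove:
  assumes V: "finite V" "m \<in> V"
  shows "chordprod d V
    = chordprod d (V-{m}) * ((\<Prod>p\<in>{p\<in>V. p < m}. d p m) * (\<Prod>q\<in>{q\<in>V. m < q}. d m q))"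
proof -
  have inner: "(\<Prod>p\<in>{p\<in>V. p < q}. d p q)
      = (\<Prod>p\<in>{p\<in>V-{m}. p < q}. d p q) * (if m < q then d m q else 1)" if "q \<in> V-{m}" for q
  proof (cases "m < q")
    case True
    then have "{p\<in>V. p < q} = insert m {p\<in>V-{m}. p < q}" using V by auto
    then show ?thesis using True V by (simp add: mult.commute)
  next
    case False
    then have "{p\<in>V. p < q} = {p\<in>V-{m}. p < q}" by auto
    then show ?thesis using False by simp
  qed
  have "(\<Prod>q\<in>V-{m}. if m < q then d m q else 1) = (\<Prod>q\<in>{q\<in>V. m < q}. d m q)"
    using V by (intro prod.mono_neutral_cong_right) auto
  then have "(\<Prod>q\<in>V-{m}. \<Prod>p\<in>{p\<in>V. p < q}. d p q) = chordprod d (V-{m}) * (\<Prod>q\<in>{q\<in>V. m < q}. d m q)"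
    unfolding chordprod_def by (simp add: inner prod.distrib)
  then show ?thesis
    using V unfolding chordprod_def[of d V] by (subst prod.remove[of V m]) simp_all
qed

text \<open>Dividing the full chord product by all chords directed towards \<open>m\<close> gives
  the product without \<open>m\<close>, up to sign: the \<open>n - m\<close> chords to later
  vertices are reversed. For even \<open>n\<close> this sign cancels the alternation up to a global
  minus, leaving reciprocal products of sines.\<close>

lemma alternating_chordprod_sum_eq_0:
  fixes \<theta> :: "int \<Rightarrow> real" and c :: real and n :: int
  defines "d \<equiv> \<lambda>p q. c * sin ((\<theta> q - \<theta> p) / 2)"
  assumes n: "0 < n" "even n"
    and nz: "\<And>p q. p \<in> {1..n} \<Longrightarrow> q \<in> {1..n} \<Longrightarrow> p \<noteq> q \<Longrightarrow> d p q \<noteq> 0"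
  shows "(\<Sum>m\<in>{1..n}. (-1) ^ nat (m+1) * chordprod d ({1..n}-{m})) = 0"
proof -
  let ?V = "{1..n}"
  have anti: "d p q = - d q p" for p q
  proof -
    have "(\<theta> q - \<theta> p) / 2 = - ((\<theta> p - \<theta> q) / 2)" by (simp add: field_simps)
    then show ?thesis unfolding d_def by (simp only: sin_minus)
  qed
  have s: "sin ((\<theta> q - \<theta> p) / 2) \<noteq> 0" if "p \<in> ?V" "q \<in> ?V" "p \<noteq> q" for p q
    using nz[OF that] unfolding d_def by auto
  have card: "card (?V-{m}) = nat (n - 1)" if "m \<in> ?V" for m
    using that by simp
  have summand: "(-1) ^ nat (m+1) * chordprod d (?V-{m})
      = - chordprod d ?V / c ^ nat (n - 1) * (1 / (\<Prod>p\<in>?V-{m}. sin ((\<theta> m - \<theta> p) / 2)))"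
    if m: "m \<in> ?V" for m
  proof -
    have fin: "finite {p\<in>?V. P p}" for P
      by (rule finite_subset[of _ ?V]) auto
    have split: "?V - {m} = {p\<in>?V. p < m} \<union> {q\<in>?V. m < q}" by auto
    have "{q\<in>?V. m < q} = {m+1..n}" using m by auto
    then have c: "card {q\<in>?V. m < q} = nat (n - m)" by simp
    have "(\<Prod>q\<in>{q\<in>?V. m < q}. d m q) = (\<Prod>q\<in>{q\<in>?V. m < q}. (-1) * d q m)"
      by (rule prod.cong[OF refl]) (subst anti, simp)
    also have "\<dots> = (-1) ^ nat (n - m) * (\<Prod>q\<in>{q\<in>?V. m < q}. d q m)"
      unfolding prod.distrib prod_constant c ..
    finally have "(\<Prod>p\<in>{p\<in>?V. p < m}. d p m) * (\<Prod>q\<in>{q\<in>?V. m < q}. d m q)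
        = (-1) ^ nat (n - m) * ((\<Prod>p\<in>{p\<in>?V. p < m}. d p m) * (\<Prod>q\<in>{q\<in>?V. m < q}. d q m))"
      by simp
    also have "(\<Prod>p\<in>{p\<in>?V. p < m}. d p m) * (\<Prod>q\<in>{q\<in>?V. m < q}. d q m) = (\<Prod>p\<in>?V-{m}. d p m)"
      unfolding split by (rule prod.union_disjoint[symmetric, OF fin fin]) auto
    finally have "chordprod d ?V = (-1) ^ nat (n - m) * (chordprod d (?V-{m}) * (\<Prod>p\<in>?V-{m}. d p m))"
      using m by (subst chordprod_remove[of _ m]) simp_all
    moreover have "(-1::real) ^ nat (n - m) = - ((-1) ^ nat (m + 1))"
      using m n(2) by (auto simp: minus_one_power_iff even_nat_iff)
    moreover have "(\<Prod>p\<in>?V-{m}. d p m) = c ^ nat (n - 1) * (\<Prod>p\<in>?V-{m}. sin ((\<theta> m - \<theta> p) / 2))"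
      unfolding d_def prod.distrib prod_constant card[OF m] ..
    moreover have "(\<Prod>p\<in>?V-{m}. d p m) \<noteq> 0"
      using nz m by simp
    ultimately show ?thesis by (simp add: field_simps)
  qed
  have "(\<Sum>m\<in>?V. (-1) ^ nat (m+1) * chordprod d (?V-{m}))
      = - chordprod d ?V / c ^ nat (n - 1) * (\<Sum>m\<in>?V. 1 / (\<Prod>p\<in>?V-{m}. sin ((\<theta> m - \<theta> p) / 2)))"
    unfolding sum_distrib_left by (rule sum.cong) (simp_all only: summand)
  also have "\<dots> = 0"
    using n s by (subst sum_inverse_prod_sin_eq_0) (auto simp: even_nat_iff)
  finally show ?thesis .
qed

section \<open>Products over indices of fixed parity\<close>

lemma finite_parity_interval [simp]:
  "finite {l::int. a \<le> l \<and> l \<le> b \<and> even l}" "finite {l::int. a \<le> l \<and> l \<le> b \<and> odd l}"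
  by (rule finite_subset[of _ "{a..b}"]; auto)+

lemma prod_even_cong:
  assumes "\<And>l. a \<le> l \<Longrightarrow> l \<le> b \<Longrightarrow> even l \<Longrightarrow> f l = g l"
  shows "prod_even f a b = prod_even g a b"
  unfolding prod_even_def by (rule prod.cong) (use assms in auto)

lemma prod_odd_cong:
  assumes "\<And>l. a \<le> l \<Longrightarrow> l \<le> b \<Longrightarrow> odd l \<Longrightarrow> f l = g l"
  shows "prod_odd f a b = prod_odd g a b"
  unfolding prod_odd_def by (rule prod.cong) (use assms in auto)

lemma prod_even_mult: "prod_even (\<lambda>l. f l * g l) a b = prod_even f a b * prod_even g a b"
  by (simp add: prod_even_def prod.distrib)

lemma prod_odd_mult: "prod_odd (\<lambda>l. f l * g l) a b = prod_odd f a b * prod_odd g a b"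
  by (simp add: prod_odd_def prod.distrib)

lemma prod_even_empty: "b < a \<Longrightarrow> prod_even f a b = 1"
  unfolding prod_even_def by (rule prod.neutral) auto

lemma prod_odd_empty: "b < a \<Longrightarrow> prod_odd f a b = 1"
  unfolding prod_odd_def by (rule prod.neutral) auto

lemma prod_even_split:
  assumes "a \<le> b + 1" "b \<le> c"
  shows "prod_even f a c = prod_even f a b * prod_even f (b+1) c"
  unfolding prod_even_def by (subst prod.union_disjoint[symmetric]) (use assms in \<open>auto intro!: prod.cong\<close>)

lemma prod_odd_split:
  assumes "a \<le> b + 1" "b \<le> c"
  shows "prod_odd f a c = prod_odd f a b * prod_odd f (b+1) c"
  unfolding prod_odd_def by (subst prod.union_disjoint[symmetric]) (use assms in \<open>auto intro!: prod.cong\<close>)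

lemma prod_even_single: "prod_even f a a = (if even a then f a else 1)"
proof -
  have "{l. a \<le> l \<and> l \<le> a \<and> even l} = (if even a then {a} else {})" by auto
  then show ?thesis by (simp add: prod_even_def)
qed

lemma prod_odd_single: "prod_odd f a a = (if odd a then f a else 1)"
proof -
  have "{l. a \<le> l \<and> l \<le> a \<and> odd l} = (if odd a then {a} else {})" by auto
  then show ?thesis by (simp add: prod_odd_def)
qed

lemma prod_even_rec:
  "prod_even f a b = (if b < a then 1 else prod_even f a (b-1) * (if even b then f b else 1))"
  using prod_even_split[of a "b-1" b f] by (simp add: prod_even_empty prod_even_single)

lemma prod_odd_rec:
  "prod_odd f a b = (if b < a then 1 else prod_odd f a (b-1) * (if odd b then f b else 1))"
  using prod_odd_split[of a "b-1" b f] by (simp add: prod_odd_empty prod_odd_single)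

lemma prod_even_step: "even b \<Longrightarrow> a \<le> b \<Longrightarrow> prod_even f a b = prod_even f a (b-2) * f b"
  by (subst prod_even_rec, subst prod_even_rec) (simp add: prod_even_empty)

lemma prod_odd_step: "odd b \<Longrightarrow> a \<le> b \<Longrightarrow> prod_odd f a b = prod_odd f a (b-2) * f b"
  by (subst prod_odd_rec, subst prod_odd_rec) (simp add: prod_odd_empty)

lemma prod_even_shift: "prod_even f (a+1) (b+1) = prod_odd (\<lambda>l. f (l+1)) a b"
  unfolding prod_even_def prod_odd_def
  by (rule prod.reindex_bij_witness[of _ "\<lambda>l. l+1" "\<lambda>l. l-1"]) auto

lemma prod_even_extend:
  assumes "a' \<le> a" "\<And>l. a' \<le> l \<Longrightarrow> l < a \<Longrightarrow> even l \<Longrightarrow> f l = 1"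
  shows "prod_even f a' b = prod_even f a b"
  unfolding prod_even_def by (rule prod.mono_neutral_right) (use assms in \<open>auto, metis not_le\<close>)

lemma prod_odd_extend:
  assumes "a' \<le> a" "\<And>l. a' \<le> l \<Longrightarrow> l < a \<Longrightarrow> odd l \<Longrightarrow> f l = 1"
  shows "prod_odd f a' b = prod_odd f a b"
  unfolding prod_odd_def by (rule prod.mono_neutral_right) (use assms in \<open>auto, metis not_le\<close>)

lemma prod_even_start_odd:
  assumes "odd a"
  shows "prod_even f a b = prod_even f (a+1) b"
proof (rule prod_even_extend)
  fix l assume "a \<le> l" "l < a + 1" "even l"
  then have "l = a" by simp
  with assms \<open>even l\<close> show "f l = 1" by simp
qed simp

lemma prod_odd_start_even:
  assumes "even a"
  shows "prod_odd f a b = prod_odd f (a+1) b"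
proof (rule prod_odd_extend)
  fix l assume "a \<le> l" "l < a + 1" "odd l"
  then have "l = a" by simp
  with assms \<open>odd l\<close> show "f l = 1" by simp
qed simp

lemma prod_odd_shift: "prod_odd f (a+1) (b+1) = prod_even (\<lambda>l. f (l+1)) a b"
  unfolding prod_even_def prod_odd_def
  by (rule prod.reindex_bij_witness[of _ "\<lambda>l. l+1" "\<lambda>l. l-1"]) auto

text \<open>Serves to move powers of \<open>\<rho>\<close> from even pair starts to odd indices,
  where they merge with those of the odd pairs. The extra index 0 is harmless because
  \<open>nat\<close> truncates its exponent.\<close>

lemma prod_even_power_shift:
  "prod_even (\<lambda>l. c ^ nat (l-1)) 2 b = prod_odd (\<lambda>l. c ^ nat (l-2)) 1 (b+1)"
proof -
  have "prod_even (\<lambda>l. c ^ nat (l-1)) 2 b = prod_even (\<lambda>l. c ^ nat (l-1)) 0 b"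
    by (rule prod_even_extend[symmetric]) auto
  also have "\<dots> = prod_odd (\<lambda>l. c ^ nat (l-2)) (0+1) (b+1)"
    unfolding prod_odd_shift by simp
  finally show ?thesis by simp
qed

text \<open>Serves to reorganise \<open>S(m)\<close>, given by rows \<open>k\<close>, into products
  over pairs \<open>{l, l+1}\<close>; the varying lower end turns into a condition on
  \<open>k\<close>.\<close>

lemma prod_even_swap:
  assumes "finite K" "\<And>k. k \<in> K \<Longrightarrow> a \<le> g k"
  shows "(\<Prod>k\<in>K. prod_even (f k) (g k) b) = prod_even (\<lambda>l. \<Prod>k\<in>{k\<in>K. g k \<le> l}. f k l) a b"
proof -
  let ?L = "{l. a \<le> l \<and> l \<le> b \<and> even l}"
  have "(\<Prod>k\<in>K. prod_even (f k) (g k) b) = (\<Prod>k\<in>K. \<Prod>l\<in>{l\<in>?L. g k \<le> l}. f k l)"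
    unfolding prod_even_def using assms(2) by (intro prod.cong refl) force+
  also have "\<dots> = (\<Prod>l\<in>?L. \<Prod>k\<in>{k\<in>K. g k \<le> l}. f k l)"
    by (rule prod.swap_restrict) (simp_all add: assms)
  finally show ?thesis unfolding prod_even_def .
qed

lemma prod_odd_swap:
  assumes "finite K" "\<And>k. k \<in> K \<Longrightarrow> a \<le> g k"
  shows "(\<Prod>k\<in>K. prod_odd (f k) (g k) b) = prod_odd (\<lambda>l. \<Prod>k\<in>{k\<in>K. g k \<le> l}. f k l) a b"
proof -
  let ?L = "{l. a \<le> l \<and> l \<le> b \<and> odd l}"
  have "(\<Prod>k\<in>K. prod_odd (f k) (g k) b) = (\<Prod>k\<in>K. \<Prod>l\<in>{l\<in>?L. g k \<le> l}. f k l)"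
    unfolding prod_odd_def using assms(2) by (intro prod.cong refl) force+
  also have "\<dots> = (\<Prod>l\<in>?L. \<Prod>k\<in>{k\<in>K. g k \<le> l}. f k l)"
    by (rule prod.swap_restrict) (simp_all add: assms)
  finally show ?thesis unfolding prod_odd_def .
qed

text \<open>The exponent acts as a parity selector: factors with even \<open>k\<close> have exponent
  0.\<close>

lemma prod_power_mod_2: "(\<Prod>k\<in>{a..b}. f k ^ nat (k mod 2)) = prod_odd f a b"
  unfolding prod_odd_def
  by (rule prod.mono_neutral_cong_right) (auto simp: odd_iff_mod_2_eq_one)

text \<open>The pairs \<open>{k, k+1}\<close> with \<open>k\<close> odd exhaust
  \<open>{1..b-1}\<close> and leave \<open>b\<close> alone.\<close>

lemma prod_pairs_odd:
  fixes f :: "int \<Rightarrow> real"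
  assumes "odd b" "1 \<le> b"
  shows "prod_odd (\<lambda>k. f k * f (k+1)) 1 (b-2) * f b = (\<Prod>k\<in>{1..b}. f k)"
proof -
  have "prod_odd (\<lambda>k. f k * f (k+1)) 1 (2 * int j + 1 - 2) * f (2 * int j + 1) = (\<Prod>k\<in>{1..2 * int j + 1}. f k)" for j
  proof (induction j)
    case 0
    then show ?case by (simp add: prod_odd_empty)
  next
    case (Suc j)
    let ?b = "2 * int j + 1"
    have "{1..2 * int (Suc j) + 1} = insert (?b+2) (insert (?b+1) {1..?b})" by auto
    then have "(\<Prod>k\<in>{1..2 * int (Suc j) + 1}. f k) = (\<Prod>k\<in>{1..?b}. f k) * f (?b+1) * f (?b+2)"
      by (simp add: mult_ac)
    also have "\<dots> = prod_odd (\<lambda>k. f k * f (k+1)) 1 ?b * f (?b+2)"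
      unfolding Suc.IH[symmetric] by (subst prod_odd_step[of ?b]) (simp_all add: mult_ac)
    finally show ?case by (simp add: algebra_simps)
  qed
  from this[of "nat ((b-1) div 2)"] show ?thesis using assms by (auto elim!: oddE)
qed

section \<open>Regrouping the triangle factors\<close>

text \<open>
  The vertices other than \<open>m\<close> are split into the pairs \<open>{l, l+1}\<close> with \<open>l\<close> even before \<open>m\<close> and \<open>l\<close> odd
  after \<open>m\<close>; for odd \<open>m\<close> the neighbours \<open>m - 1\<close> and \<open>m + 1\<close> are left over, and they are joined to the
  earlier vertices by the triangles on the chords \<open>{k, k+1}\<close> with \<open>k\<close> odd.
\<close>

lemma Sfac_even:
  assumes "even m" "1 \<le> m"
  shows "Sfac n A m
    = prod_even (\<lambda>l. \<Prod>k\<in>{1..l-1}. hS A k l (l+1)) 2 (m-2)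
      * prod_odd (\<lambda>l. \<Prod>k\<in>{1..l-1}-{m}. hS A k l (l+1)) (m+1) (n-1)"
proof -
  have 1: "(\<Prod>k\<in>{1..m-1}. prod_even (\<lambda>l. hS A k l (l+1)) (k+1) (m-2))
      = prod_even (\<lambda>l. \<Prod>k\<in>{1..l-1}. hS A k l (l+1)) 2 (m-2)"
    by (subst prod_even_swap[where a=2]) (auto intro!: prod_even_cong prod.cong)
  have 2: "(\<Prod>k\<in>{1..m-1}. prod_odd (\<lambda>l. hS A k l (l+1)) (m+1) (n-1))
      = prod_odd (\<lambda>l. \<Prod>k\<in>{1..m-1}. hS A k l (l+1)) (m+1) (n-1)"
    by (subst prod_odd_swap[where a="m+1"]) (auto intro!: prod_odd_cong prod.cong)
  \<comment> \<open>The condition \<open>k + 2 \<le> l\<close> bounds the shifted index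
    \<open>k + 1\<close> by \<open>l - 1\<close>; it also implies \<open>k \<le> n - 3\<close>,
    since \<open>l \<le> n - 1\<close>.\<close>
  have 3: "(\<Prod>k\<in>{m..n-3}. prod_odd (\<lambda>l. hS A (k+1) l (l+1)) (k+2) (n-1))
      = prod_odd (\<lambda>l. \<Prod>k\<in>{m+1..l-1}. hS A k l (l+1)) (m+1) (n-1)"
    by (subst prod_odd_swap[where a="m+1"])
      (auto intro!: prod_odd_cong prod.reindex_bij_witness[of _ "\<lambda>k. k-1" "\<lambda>k. k+1"])
  have 4: "(\<Prod>k\<in>{1..m-1}. hS A k l (l+1)) * (\<Prod>k\<in>{m+1..l-1}. hS A k l (l+1))
      = (\<Prod>k\<in>{1..l-1}-{m}. hS A k l (l+1))" if "m+1 \<le> l" for l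
    by (subst prod.union_disjoint[symmetric]) (use that assms in \<open>auto intro!: prod.cong\<close>)
  have "prod_odd (\<lambda>l. \<Prod>k\<in>{1..m-1}. hS A k l (l+1)) (m+1) (n-1)
      * prod_odd (\<lambda>l. \<Prod>k\<in>{m+1..l-1}. hS A k l (l+1)) (m+1) (n-1)
    = prod_odd (\<lambda>l. \<Prod>k\<in>{1..l-1}-{m}. hS A k l (l+1)) (m+1) (n-1)"
    unfolding prod_odd_mult[symmetric] by (rule prod_odd_cong) (rule 4)
  then show ?thesis
    unfolding Sfac_def using assms by (simp add: prod.distrib 1 2 3)
qed

lemma Sfac_odd:
  assumes "odd m" "1 \<le> m"
  shows "Sfac n A m
    = hS A (m-2) (m-1) (m+1)
      * prod_even (\<lambda>l. \<Prod>k\<in>{1..l-1}. hS A k l (l+1)) 2 (m-3)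
      * prod_odd (\<lambda>k. hS A k (k+1) (m-1) * hS A k (k+1) (m+1)) 1 (m-4)
      * prod_odd (\<lambda>l. \<Prod>k\<in>{1..l-1}-{m}. hS A k l (l+1)) (m+2) (n-1)"
proof -
  let ?T = "\<lambda>k l. hS A k l (l+1)"
  have 1: "(\<Prod>k\<in>{1..m-4}. prod_even (?T k) (k+2) (m-2))
      = prod_even (\<lambda>l. \<Prod>k\<in>{1..l-2}. ?T k l) 2 (m-3)"
  proof -
    have "(\<Prod>k\<in>{1..m-4}. prod_even (?T k) (k+2) (m-2))
      = prod_even (\<lambda>l. \<Prod>k\<in>{k\<in>{1..m-4}. k+2 \<le> l}. ?T k l) 2 (m-2)"
      by (rule prod_even_swap) auto
    \<comment> \<open>\<open>m - 2\<close> is odd, so no even index is lost.\<close>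
    also have "\<dots> = prod_even (\<lambda>l. \<Prod>k\<in>{k\<in>{1..m-4}. k+2 \<le> l}. ?T k l) 2 (m-3)"
      by (subst prod_even_rec) (use assms in \<open>simp add: prod_even_empty\<close>)
    also have "\<dots> = prod_even (\<lambda>l. \<Prod>k\<in>{1..l-2}. ?T k l) 2 (m-3)"
      using assms by (auto intro!: prod_even_cong prod.cong)
    finally show ?thesis .
  qed
  \<comment> \<open>With \<open>l = k + 1\<close>, the triangles on \<open>k, k+1, k+2\<close> for
    odd \<open>k\<close> become the factors for \<open>l - 1\<close> that the product in
    \<open>1\<close> lacks.\<close>
  have 2: "(\<Prod>k\<in>{1..m-4}. (hS A k (k+1) (k+2) * hS A k (k+1) (m-1) * hS A k (k+1) (m+1)) ^ nat (k mod 2))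
      = prod_even (\<lambda>l. ?T (l-1) l) 2 (m-3) * prod_odd (\<lambda>k. hS A k (k+1) (m-1) * hS A k (k+1) (m+1)) 1 (m-4)"
    unfolding prod_power_mod_2
    using prod_even_shift[of "\<lambda>l. ?T (l-1) l" 1 "m-4"] by (simp add: prod_odd_mult mult_ac add_ac)
  have 3: "prod_even (\<lambda>l. ?T (l-1) l) 2 (m-3) * prod_even (\<lambda>l. \<Prod>k\<in>{1..l-2}. ?T k l) 2 (m-3)
      = prod_even (\<lambda>l. \<Prod>k\<in>{1..l-1}. ?T k l) 2 (m-3)"
    unfolding prod_even_mult[symmetric]
  proof (rule prod_even_cong)
    fix l :: int assume "2 \<le> l"
    then have "{1..l-1} = insert (l-1) {1..l-2}" by auto
    then show "?T (l-1) l * (\<Prod>k\<in>{1..l-2}. ?T k l) = (\<Prod>k\<in>{1..l-1}. ?T k l)" by simp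
  qed
  have 4: "(\<Prod>k\<in>{1..m-4}. prod_odd (?T k) (m+2) (n-1))
      = prod_odd (\<lambda>l. \<Prod>k\<in>{1..m-4}. ?T k l) (m+2) (n-1)"
    by (subst prod_odd_swap[where a="m+2"]) (auto intro!: prod_odd_cong prod.cong)
  have 5: "(\<Prod>k\<in>{m..n-3}. prod_odd (\<lambda>l. hS A (k+1) l (l+1)) (k+2) (n-1))
      = prod_odd (\<lambda>l. \<Prod>k\<in>{m+1..l-1}. ?T k l) (m+2) (n-1)"
    by (subst prod_odd_swap[where a="m+2"])
      (auto intro!: prod_odd_cong prod.reindex_bij_witness[of _ "\<lambda>k. k-1" "\<lambda>k. k+1"])
  have 6: "?T (m-1) l * ?T (m-2) l * ?T (m-3) l * (\<Prod>k\<in>{m+1..l-1}. ?T k l) * (\<Prod>k\<in>{1..m-4}. ?T k l)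
      = (\<Prod>k\<in>{1..l-1}-{m}. ?T k l)" if "m+2 \<le> l" for l
  proof -
    have "{m-3..m-1} = {m-1,m-2,m-3}" by auto
    then have "?T (m-1) l * ?T (m-2) l * ?T (m-3) l = (\<Prod>k\<in>{m-3..m-1}. ?T k l)" by simp
    \<comment> \<open>entries with a nonpositive index are 1 by convention\<close>
    also have "\<dots> = (\<Prod>k\<in>{max 1 (m-3)..m-1}. ?T k l)"
      by (rule prod.mono_neutral_right) (auto simp: hS_def)
    finally have "?T (m-1) l * ?T (m-2) l * ?T (m-3) l * (\<Prod>k\<in>{m+1..l-1}. ?T k l) * (\<Prod>k\<in>{1..m-4}. ?T k l)
        = (\<Prod>k\<in>{max 1 (m-3)..m-1}. ?T k l) * (\<Prod>k\<in>{m+1..l-1} \<union> {1..m-4}. ?T k l)"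
      using that by (subst prod.union_disjoint) auto
    also have "\<dots> = (\<Prod>k\<in>{max 1 (m-3)..m-1} \<union> ({m+1..l-1} \<union> {1..m-4}). ?T k l)"
      using that by (intro prod.union_disjoint[symmetric]) auto
    also have "{max 1 (m-3)..m-1} \<union> ({m+1..l-1} \<union> {1..m-4}) = {1..l-1}-{m}"
      using that assms(2) by auto
    finally show ?thesis .
  qed
  have 7: "prod_odd (\<lambda>l. ?T (m-1) l * ?T (m-2) l * ?T (m-3) l) (m+2) (n-1)
      * prod_odd (\<lambda>l. \<Prod>k\<in>{m+1..l-1}. ?T k l) (m+2) (n-1)
      * prod_odd (\<lambda>l. \<Prod>k\<in>{1..m-4}. ?T k l) (m+2) (n-1)
    = prod_odd (\<lambda>l. \<Prod>k\<in>{1..l-1}-{m}. ?T k l) (m+2) (n-1)"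
    unfolding prod_odd_mult[symmetric] by (rule prod_odd_cong) (rule 6)
  show ?thesis
    unfolding Sfac_def prod.distrib 1 2 4 5 3[symmetric] 7[symmetric]
    using assms by simp
qed

section \<open>The summands as chord monomials\<close>

text \<open>Isolates all that the bookkeeping needs from the circle. \<open>d\<close> is the signed
  chord length and \<open>\<rho>\<close> the inverse radius: four times a triangle's area is the
  product of its sides over the circumradius.\<close>

locale chords =
  fixes n :: int and A :: "int \<Rightarrow> real \<times> real" and d :: "int \<Rightarrow> int \<Rightarrow> real" and \<rho> :: real
  assumes hx_chord: "\<And>p q. p \<in> {1..n} \<Longrightarrow> q \<in> {1..n} \<Longrightarrow> hx A p q = (d p q)\<^sup>2"
    and hS_chord: "\<And>p q s. p \<in> {1..n} \<Longrightarrow> q \<in> {1..n} \<Longrightarrow> s \<in> {1..n}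
      \<Longrightarrow> hS A p q s = \<rho> * (d p q * d p s * d q s)"
begin

abbreviation "D \<equiv> chordprod d"
abbreviation "U \<equiv> \<lambda>l. d l (l+1)"

text \<open>Each triangle on \<open>k, l, l+1\<close> supplies the two new chords at
  \<open>k\<close> and a copy of \<open>U l\<close>. The enlarged chord product uses up just one
  copy, so \<open>card V - 1\<close> are left over; a nonempty \<open>V\<close> guarantees that
  one.\<close>

lemma chordprod_add_pair:
  assumes "V \<subseteq> {1..l-1}" "V \<noteq> {}" "l + 1 \<le> n"
  shows "D V * (\<Prod>k\<in>V. hS A k l (l+1))
    = D (insert (l+1) (insert l V)) * (U l ^ (card V - 1) * \<rho> ^ card V)"
proof -
  have fin: "finite V" using assms(1) by (rule finite_subset) simp
  then obtain c where c: "card V = Suc c"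
    using assms(2) by (metis card_0_eq not0_implies_Suc)
  have V: "1 \<le> k \<and> k < l" if "k \<in> V" for k using that assms(1) by auto
  then have l: "l \<notin> V" by blast
  have "(\<Prod>k\<in>V. hS A k l (l+1)) = (\<Prod>k\<in>V. \<rho> * (d k l * d k (l+1) * U l))"
    using V assms(3) by (intro prod.cong refl hS_chord) force+
  also have "\<dots> = \<rho> ^ card V * ((\<Prod>k\<in>V. d k l) * (\<Prod>k\<in>V. d k (l+1)) * U l ^ card V)"
    by (simp add: prod.distrib)
  finally have 1: "(\<Prod>k\<in>V. hS A k l (l+1)) = \<rho> ^ card V * ((\<Prod>k\<in>V. d k l) * (\<Prod>k\<in>V. d k (l+1)) * U l ^ card V)" .
  have "D (insert (l+1) (insert l V)) = D (insert l V) * (U l * (\<Prod>k\<in>V. d k (l+1)))"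
    using fin l V by (subst chordprod_insert_max) (auto dest!: V)
  also have "D (insert l V) = D V * (\<Prod>k\<in>V. d k l)"
    using fin V by (subst chordprod_insert_max) auto
  finally show ?thesis by (simp add: 1 c mult_ac)
qed

text \<open>Starting from \<open>{1}\<close>, the pairs \<open>{2,3}\<close>, \<open>{4,5}\<close>,
  ... are added in turn; before the pair at \<open>l\<close> there are \<open>l - 1\<close>
  vertices.\<close>

lemma prod_even_triangles:
  assumes "even M" "0 \<le> M" "M \<le> n"
  shows "prod_even (\<lambda>l. \<Prod>k\<in>{1..l-1}. hS A k l (l+1)) 2 (M-2)
    = D {1..M-1} * prod_even (\<lambda>l. U l ^ nat (l-2) * \<rho> ^ nat (l-1)) 2 (M-2)"
proof -
  have "prod_even (\<lambda>l. \<Prod>k\<in>{1..l-1}. hS A k l (l+1)) 2 (2 * int j - 2)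
    = D {1..2 * int j - 1} * prod_even (\<lambda>l. U l ^ nat (l-2) * \<rho> ^ nat (l-1)) 2 (2 * int j - 2)"
    if "2 * int j \<le> n" for j
    using that
  proof (induction j)
    case 0
    then show ?case by (simp add: prod_even_empty)
  next
    case (Suc j)
    let ?l = "2 * int j"
    show ?case
    proof (cases "j = 0")
      \<comment> \<open>The next set is \<open>{1}\<close>, so no pair has been added yet.\<close>
      case True
      then show ?thesis by (simp add: prod_even_empty)
    next
      case False
      have ins: "insert (?l+1) (insert ?l {1..?l-1}) = {1..?l+1}" using False by auto
      have "nat (?l-1) - 1 = nat (?l-2)" by simp
      then have "D {1..?l-1} * (\<Prod>k\<in>{1..?l-1}. hS A k ?l (?l+1))
          = D {1..?l+1} * (U ?l ^ nat (?l-2) * \<rho> ^ nat (?l-1))"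
        using chordprod_add_pair[of "{1..?l-1}" ?l] False Suc.prems
        by (simp add: ins)
      moreover have l: "even ?l" "2 \<le> ?l" using False by auto
      moreover have idx: "2 * int (Suc j) - 2 = ?l" "2 * int (Suc j) - 1 = ?l + 1" by auto
      ultimately show ?thesis
        unfolding idx prod_even_step[OF l] using Suc by (simp add: mult_ac(2,3))
    qed
  qed
  from this[of "nat (M div 2)"] show ?thesis using assms by (auto elim!: evenE)
qed

text \<open>The same construction beyond \<open>m\<close>: with \<open>m\<close> missing, only
  \<open>l - 2\<close> vertices precede the pair at \<open>l\<close>, which lowers both exponents by
  one.\<close>

lemma prod_odd_triangles:
  assumes "odd a" "3 \<le> a" "1 \<le> m" "m < a" "even N" "a \<le> N + 1" "N \<le> n"
  shows "D ({1..a-1}-{m}) * prod_odd (\<lambda>l. \<Prod>k\<in>{1..l-1}-{m}. hS A k l (l+1)) a (N-1)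
    = D ({1..N}-{m}) * prod_odd (\<lambda>l. U l ^ nat (l-3) * \<rho> ^ nat (l-2)) a (N-1)"
proof -
  have "D ({1..a-1}-{m}) * prod_odd (\<lambda>l. \<Prod>k\<in>{1..l-1}-{m}. hS A k l (l+1)) a (a - 2 + 2 * int j)
    = D ({1..a-1+2 * int j}-{m}) * prod_odd (\<lambda>l. U l ^ nat (l-3) * \<rho> ^ nat (l-2)) a (a - 2 + 2 * int j)"
    if "a - 1 + 2 * int j \<le> n" for j
    using that
  proof (induction j)
    case 0
    then show ?case by (simp add: prod_odd_empty)
  next
    case (Suc j)
    let ?l = "a + 2 * int j"
    have l: "odd ?l" "a \<le> ?l" using assms by auto
    have "card ({1..?l-1}-{m}) = nat (?l-2)" using assms by (simp add: nat_diff_distrib')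
    moreover have "insert (?l+1) (insert ?l ({1..?l-1}-{m})) = {1..?l+1}-{m}" using assms by auto
    \<comment> \<open>A witness that vertices remain after removing \<open>m\<close>, as
      \<open>chordprod_add_pair\<close> requires.\<close>
    moreover have "(if m = 1 then 2 else 1) \<in> {1..?l-1}-{m}" using assms by auto
    then have "{1..?l-1}-{m} \<noteq> {}" by blast
    moreover have "nat (?l-2) - 1 = nat (?l-3)" using assms by auto
    ultimately have step: "D ({1..?l-1}-{m}) * (\<Prod>k\<in>{1..?l-1}-{m}. hS A k ?l (?l+1))
        = D ({1..?l+1}-{m}) * (U ?l ^ nat (?l-3) * \<rho> ^ nat (?l-2))"
      using chordprod_add_pair[of "{1..?l-1}-{m}" ?l] Suc.prems by auto
    have idx: "a - 2 + 2 * int j = ?l - 2" "a - 1 + 2 * int j = ?l - 1"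
      "a - 2 + 2 * int (Suc j) = ?l" "a - 1 + 2 * int (Suc j) = ?l + 1" by auto
    have IH: "D ({1..a-1}-{m}) * prod_odd (\<lambda>l. \<Prod>k\<in>{1..l-1}-{m}. hS A k l (l+1)) a (?l-2)
        = D ({1..?l-1}-{m}) * prod_odd (\<lambda>l. U l ^ nat (l-3) * \<rho> ^ nat (l-2)) a (?l-2)"
      using Suc unfolding idx by simp
    show ?case
      unfolding idx prod_odd_step[OF l] mult.assoc[symmetric] IH
      using step by (simp add: mult_ac)
  qed
  from this[of "nat ((N + 1 - a) div 2)"] show ?thesis using assms by (auto elim!: oddE evenE)
qed

section \<open>Edge powers in the factors \<open>x(m)\<close>\<close>

lemma hxp_chord:
  assumes "1 \<le> l" "l + 1 \<le> n" "0 \<le> e"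
  shows "hxp A l (l+1) e = U l ^ nat (2 * e)"
  using assms by (simp add: hxp_def hx_chord nat_mult_distrib power_mult)

lemma prod_even_hxp:
  assumes "0 \<le> a" "b + 1 \<le> n"
  shows "prod_even (\<lambda>l. hxp A l (l+1) ((l-2) div 2)) a b = prod_even (\<lambda>l. U l ^ nat (l-2)) a b"
proof (rule prod_even_cong)
  fix l assume l: "a \<le> l" "l \<le> b" "even l"
  show "hxp A l (l+1) ((l-2) div 2) = U l ^ nat (l-2)"
  proof (cases "l = 0")
    \<comment> \<open>Index 0 arises from the lower end \<open>m - 1\<close> at
      \<open>m = 1\<close>. The exponent is -1, so the convention gives 1, matching the truncation
      by \<open>nat\<close>.\<close>
    case True
    then show ?thesis by (simp add: hxp_def)
  next
    case False
    with l assms have "2 \<le> l" by presburger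
    with l assms show ?thesis by (subst hxp_chord) auto
  qed
qed

text \<open>The indices 1 and 3 can be included because \<open>nat (l-3)\<close> is 0 there.\<close>

lemma prod_odd_hxp:
  assumes "b + 1 \<le> n"
  shows "prod_odd (\<lambda>l. hxp A l (l+1) ((l-3) div 2)) 5 b = prod_odd (\<lambda>l. U l ^ nat (l-3)) 1 b"
proof -
  have "prod_odd (\<lambda>l. hxp A l (l+1) ((l-3) div 2)) 5 b = prod_odd (\<lambda>l. U l ^ nat (l-3)) 5 b"
    using assms by (intro prod_odd_cong) (simp add: hxp_chord)
  also have "\<dots> = prod_odd (\<lambda>l. U l ^ nat (l-3)) 1 b"
  proof (rule prod_odd_extend[symmetric])
    fix l :: int assume "1 \<le> l" "l < 5" "odd l"
    then have "l = 1 \<or> l = 3" by presburger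
    then show "U l ^ nat (l-3) = 1" by auto
  qed simp
  finally show ?thesis .
qed

text \<open>The squares raise the exponents \<open>(l-5) div 2\<close> to \<open>(l-3) div 2\<close>
  from index 5 on. Those at 1 and 3 are left over and play the part of \<open>x12\<close> and
  \<open>x34\<close>.\<close>

lemma prod_odd_hxp_squares:
  assumes "b + 1 \<le> n" "3 \<le> b"
  shows "prod_odd (\<lambda>l. hxp A l (l+1) ((l-5) div 2)) 5 b * prod_odd (\<lambda>l. (U l)\<^sup>2) 1 b
    = (U 1)\<^sup>2 * (U 3)\<^sup>2 * prod_odd (\<lambda>l. U l ^ nat (l-3)) 1 b"
proof -
  have "prod_odd (\<lambda>l. (U l)\<^sup>2) 1 b = prod_odd (\<lambda>l. (U l)\<^sup>2) 1 3 * prod_odd (\<lambda>l. (U l)\<^sup>2) (3+1) b"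
    using assms by (intro prod_odd_split) auto
  also have "prod_odd (\<lambda>l. (U l)\<^sup>2) (3+1) b = prod_odd (\<lambda>l. (U l)\<^sup>2) 5 b"
    using prod_odd_start_even[of 4] by simp
  also have "prod_odd (\<lambda>l. (U l)\<^sup>2) 1 3 = (U 1)\<^sup>2 * (U 3)\<^sup>2"
    using prod_odd_step[of 3 1 "\<lambda>l. (U l)\<^sup>2"] by (simp add: prod_odd_single)
  finally have "prod_odd (\<lambda>l. hxp A l (l+1) ((l-5) div 2)) 5 b * prod_odd (\<lambda>l. (U l)\<^sup>2) 1 b
    = (U 1)\<^sup>2 * (U 3)\<^sup>2 * prod_odd (\<lambda>l. hxp A l (l+1) ((l-5) div 2) * (U l)\<^sup>2) 5 b"
    by (simp add: prod_odd_mult mult_ac)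
  also have "prod_odd (\<lambda>l. hxp A l (l+1) ((l-5) div 2) * (U l)\<^sup>2) 5 b
      = prod_odd (\<lambda>l. hxp A l (l+1) ((l-3) div 2)) 5 b"
  proof (rule prod_odd_cong)
    fix l assume l: "5 \<le> l" "l \<le> b" "odd l"
    have "nat (l-3) = nat (l-5) + 2" using l by auto
    then show "hxp A l (l+1) ((l-5) div 2) * (U l)\<^sup>2 = hxp A l (l+1) ((l-3) div 2)"
      using l assms by (simp add: hxp_chord power_add power2_eq_square)
  qed
  finally show ?thesis using prod_odd_hxp[OF assms(1)] by simp
qed

text \<open>Multiplying by edge squares, which will be split off from \<open>S(m)\<close>, brings
  odd \<open>m\<close> to the same shape as even \<open>m\<close>.\<close>

lemma xfac_odd:
  assumes n: "4 < n" "even n" and m: "odd m" "1 \<le> m" "m \<le> n"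
  shows "xfac n A m * prod_odd (\<lambda>l. (U l)\<^sup>2) 1 (m-4)
    = hx A 1 2 * hxp A 3 4 (if n = 6 then 0 else 1)
      * prod_even (\<lambda>l. U l ^ nat (l-2)) (m-1) (n-2) * prod_odd (\<lambda>l. U l ^ nat (l-3)) 1 m"
proof -
  have mn: "m + 1 \<le> n" using n m by presburger
  have n6: "6 \<le> n" using n by presburger
  have x12: "hx A 1 2 = (U 1)\<^sup>2" and x34: "hx A 3 4 = (U 3)\<^sup>2"
    using hx_chord[of 1 2] hx_chord[of 3 4] n6 by auto
  have hxp1: "hxp A p q 1 = hx A p q" and hxp0: "hxp A p q 0 = 1" and hxpm: "hxp A p q (-1) = 1"
    and hxpm2: "hxp A p q (-2) = 1" for p q
    by (simp_all add: hxp_def)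
  have E: "prod_even (\<lambda>l. hxp A l (l+1) ((l-2) div 2)) (m-1) (n-2) = prod_even (\<lambda>l. U l ^ nat (l-2)) (m-1) (n-2)"
    using m by (intro prod_even_hxp) auto
  have O: "prod_odd (\<lambda>l. hxp A l (l+1) ((l-3) div 2)) 5 m = prod_odd (\<lambda>l. U l ^ nat (l-3)) 1 m"
    using mn by (rule prod_odd_hxp)
  have O1: "prod_odd (\<lambda>l. U l ^ nat (l-3)) 1 1 = 1" by (simp add: prod_odd_single)
  have O3: "prod_odd (\<lambda>l. U l ^ nat (l-3)) 1 3 = 1"
    using prod_odd_step[of 3 1 "\<lambda>l. U l ^ nat (l-3)"] O1 by simp
  have O5: "prod_odd (\<lambda>l. U l ^ nat (l-3)) 1 5 = (U 5)\<^sup>2"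
    using prod_odd_step[of 5 1 "\<lambda>l. U l ^ nat (l-3)"] O3 by simp
  have x6: "xfac n A m = hxp A 1 2 (if m \<in> {1,3} then 1 else 0)
      * prod_even (\<lambda>l. U l ^ nat (l-2)) (m-1) (n-2) * prod_odd (\<lambda>l. U l ^ nat (l-3)) 1 m" if "n = 6"
    unfolding xfac_def Let_def E[symmetric] O[symmetric] using m that by simp
  have x8: "xfac n A m = hxp A 1 2 (if m \<in> {1,3} then 1 else 0) * hxp A 3 4 (if m \<in> {1,3,5} then 1 else 0)
      * hxp A (m-2) (m-1) ((m-5) div 2) * hxp A m (m+1) ((m-3) div 2)
      * prod_even (\<lambda>l. U l ^ nat (l-2)) (m-1) (n-2)
      * prod_odd (\<lambda>l. hxp A l (l+1) ((l-5) div 2)) 5 (m-4)" if "n \<noteq> 6"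
    unfolding xfac_def Let_def E[symmetric] using m that by simp
  \<comment> \<open>For \<open>m\<close> equal to 1 or 3 there are no squares, so \<open>a\<close>
    and, for \<open>n > 6\<close>, \<open>b\<close> supply the missing edges. At 5 the square of
    \<open>U 1\<close> replaces \<open>x12\<close>; from 7 on the squares yield both.\<close>
  have "m = 1 \<or> m = 3 \<or> m = 5 \<or> 7 \<le> m" using m by presburger
  then consider "m = 1" | "m = 3" | "m = 5" | "7 \<le> m" by blast
  then show ?thesis
  proof cases
    case 1
    then show ?thesis using x6 x8 O1
      by (cases "n = 6") (simp_all add: hxp1 hxp0 hxpm hxpm2 prod_odd_empty)
  next
    case 2
    then show ?thesis using x6 x8 O3
      by (cases "n = 6") (simp_all add: hxp1 hxp0 hxpm hxpm2 prod_odd_empty)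
  next
    case 3
    then show ?thesis using x6 x8 O5 hx_chord[of 5 6] n6
      by (cases "n = 6") (simp_all add: hxp1 hxp0 hxpm hxpm2 prod_odd_empty prod_odd_single x12)
  next
    case 4
    \<comment> \<open>The squares stop at \<open>m - 4\<close>, so the edges at \<open>m - 2\<close>
      and \<open>m\<close> carry their full exponents as separate factors.\<close>
    have "prod_odd (\<lambda>l. U l ^ nat (l-3)) 1 m
        = prod_odd (\<lambda>l. U l ^ nat (l-3)) 1 (m-4) * U (m-2) ^ nat (m-5) * U m ^ nat (m-3)"
      using m 4 by (simp add: prod_odd_step[of m] prod_odd_step[of "m-2"])
    moreover have "hxp A (m-2) (m-1) ((m-5) div 2) = U (m-2) ^ nat (m-5)"
      using hxp_chord[of "m-2" "(m-5) div 2"] m mn 4 by simp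
    moreover have "hxp A m (m+1) ((m-3) div 2) = U m ^ nat (m-3)"
      using hxp_chord[of m "(m-3) div 2"] m mn 4 by simp
    moreover have "n \<noteq> 6" using 4 m mn by auto
    moreover note x8[OF this]
    ultimately show ?thesis
      using prod_odd_hxp_squares[of "m-4"] mn 4
      by (simp add: hxp1 hxp0 x12 x34 mult_ac)
  qed
qed

text \<open>Joins \<open>m - 1\<close> and \<open>m + 1\<close> to \<open>{1..m-2}\<close>. The two
  triangles on each edge \<open>{k, k+1}\<close> reach all of \<open>{1..m-3}\<close> and leave a
  square of \<open>U k\<close>; the triangle on \<open>m-2, m-1, m+1\<close> supplies the other
  three chords.\<close>

lemma triangles_around_odd:
  assumes "odd m" "1 \<le> m" "m + 1 \<le> n"
  shows "hS A (m-2) (m-1) (m+1) * D {1..m-2}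
      * prod_odd (\<lambda>k. hS A k (k+1) (m-1) * hS A k (k+1) (m+1)) 1 (m-4)
    = D ({1..m+1}-{m}) * prod_odd (\<lambda>k. (U k)\<^sup>2) 1 (m-4) * \<rho> ^ nat (m-2)"
proof (cases "m = 1")
  \<comment> \<open>The triangle has nonpositive indices, hence value 1, and
    \<open>nat (m-2)\<close> is 0.\<close>
  case True
  have "{1..2} - {1::int} = {2}" by auto
  with True show ?thesis by (simp add: hS_def prod_odd_empty)
next
  case False
  with assms have m3: "3 \<le> m" by presburger
  have V: "{1..m+1}-{m} = insert (m+1) (insert (m-1) {1..m-2})" using m3 by auto
  have "D ({1..m+1}-{m}) = D (insert (m-1) {1..m-2}) * (\<Prod>k\<in>insert (m-1) {1..m-2}. d k (m+1))"
    unfolding V by (rule chordprod_insert_max) auto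
  also have "D (insert (m-1) {1..m-2}) = D {1..m-2} * (\<Prod>k\<in>{1..m-2}. d k (m-1))"
    by (rule chordprod_insert_max) auto
  finally have D: "D ({1..m+1}-{m})
      = D {1..m-2} * (\<Prod>k\<in>{1..m-2}. d k (m-1)) * (d (m-1) (m+1) * (\<Prod>k\<in>{1..m-2}. d k (m+1)))"
    by simp
  have pairs: "(\<Prod>k\<in>{1..m-2}. d k q) = prod_odd (\<lambda>k. d k q * d (k+1) q) 1 (m-4) * d (m-2) q" for q
    using prod_pairs_odd[of "m-2" "\<lambda>k. d k q"] assms m3 by simp
  have "prod_odd (\<lambda>k. hS A k (k+1) (m-1) * hS A k (k+1) (m+1)) 1 (m-4)
      = prod_odd (\<lambda>k. \<rho>\<^sup>2 * (U k)\<^sup>2 * ((d k (m-1) * d (k+1) (m-1)) * (d k (m+1) * d (k+1) (m+1)))) 1 (m-4)"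
    using assms by (intro prod_odd_cong) (simp add: hS_chord power2_eq_square mult_ac)
  also have "\<dots> = prod_odd (\<lambda>k. \<rho>\<^sup>2) 1 (m-4) * prod_odd (\<lambda>k. (U k)\<^sup>2) 1 (m-4)
      * (prod_odd (\<lambda>k. d k (m-1) * d (k+1) (m-1)) 1 (m-4) * prod_odd (\<lambda>k. d k (m+1) * d (k+1) (m+1)) 1 (m-4))"
    by (simp only: prod_odd_mult)
  finally have tri: "prod_odd (\<lambda>k. hS A k (k+1) (m-1) * hS A k (k+1) (m+1)) 1 (m-4) = \<dots>" .
  \<comment> \<open>The powers of \<open>\<rho>\<close> are counted by the same pairing, applied to
    a constant function.\<close>
  have "prod_odd (\<lambda>k. \<rho>\<^sup>2) 1 (m-4) * \<rho> = (\<Prod>k\<in>{1..m-2}. \<rho>)"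
    using prod_pairs_odd[of "m-2" "\<lambda>k. \<rho>"] assms m3 by (simp add: power2_eq_square)
  then have rho: "\<rho> ^ nat (m-2) = prod_odd (\<lambda>k. \<rho>\<^sup>2) 1 (m-4) * \<rho>" by simp
  have "hS A (m-2) (m-1) (m+1) = \<rho> * (d (m-2) (m-1) * d (m-2) (m+1) * d (m-1) (m+1))"
    using assms m3 by (intro hS_chord) auto
  then show ?thesis
    by (simp add: D pairs tri rho mult_ac)
qed

text \<open>The surplus common to all \<open>m\<close>. Starting the products at 0 and 1 makes their
  ranges split at every \<open>m\<close>; the truncated exponents there add nothing.\<close>

definition "K = hx A 1 2 * hxp A 3 4 (if n = 6 then 0 else 1)
  * prod_even (\<lambda>l. U l ^ nat (l-2)) 0 (n-2) * prod_odd (\<lambda>l. U l ^ nat (l-3) * \<rho> ^ nat (l-2)) 1 (n-1)"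

text \<open>The edge powers are complementary: \<open>x(m)\<close> has the even edges from
  \<open>m\<close> on and the odd ones before \<open>m\<close>, while the surplus of
  \<open>S(m)\<close> has the even edges before \<open>m\<close> and the odd ones after it.\<close>

lemma xfac_Sfac_even:
  assumes n: "even n" and m: "even m" "1 \<le> m" "m \<le> n"
  shows "xfac n A m * Sfac n A m = K * D ({1..n}-{m})"
proof -
  have m2: "2 \<le> m" using m by presburger
  have x: "xfac n A m = hx A 1 2 * hxp A 3 4 (if n = 6 then 0 else 1)
      * prod_even (\<lambda>l. U l ^ nat (l-2)) m (n-2) * prod_odd (\<lambda>l. U l ^ nat (l-3)) 1 (m-1)"
    using m by (simp add: xfac_def prod_even_hxp prod_odd_hxp)
  have "{1..m+1-1}-{m} = {1..m-1}" by auto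
  then have "D {1..m-1} * prod_odd (\<lambda>l. \<Prod>k\<in>{1..l-1}-{m}. hS A k l (l+1)) (m+1) (n-1)
      = D ({1..n}-{m}) * prod_odd (\<lambda>l. U l ^ nat (l-3) * \<rho> ^ nat (l-2)) (m+1) (n-1)"
    using prod_odd_triangles[of "m+1" m n] n m m2 by simp
  then have "Sfac n A m = D ({1..n}-{m}) * prod_odd (\<lambda>l. U l ^ nat (l-3) * \<rho> ^ nat (l-2)) (m+1) (n-1)
      * prod_even (\<lambda>l. U l ^ nat (l-2) * \<rho> ^ nat (l-1)) 2 (m-2)"
    unfolding Sfac_even[OF m(1,2)] using prod_even_triangles[of m] m by (simp add: mult_ac)
  also have "prod_even (\<lambda>l. U l ^ nat (l-2) * \<rho> ^ nat (l-1)) 2 (m-2)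
      = prod_even (\<lambda>l. U l ^ nat (l-2)) 0 (m-2) * prod_odd (\<lambda>l. \<rho> ^ nat (l-2)) 1 (m-1)"
    unfolding prod_even_mult prod_even_power_shift
    by (subst prod_even_extend[of 0 2]) auto
  finally have S: "Sfac n A m = D ({1..n}-{m}) * prod_odd (\<lambda>l. U l ^ nat (l-3) * \<rho> ^ nat (l-2)) (m+1) (n-1)
      * (prod_even (\<lambda>l. U l ^ nat (l-2)) 0 (m-2) * prod_odd (\<lambda>l. \<rho> ^ nat (l-2)) 1 (m-1))" .
  have odd_split: "prod_odd f 1 (n-1) = prod_odd f 1 (m-1) * prod_odd f (m+1) (n-1)" for f
    using prod_odd_split[of 1 "m-1" "n-1" f] prod_odd_start_even[of m f "n-1"] m by simp
  have even_split: "prod_even f 0 (n-2) = prod_even f 0 (m-2) * prod_even f m (n-2)" for f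
    using prod_even_split[of 0 "m-2" "n-2" f] prod_even_start_odd[of "m-1" f "n-2"] m m2 by simp
  show ?thesis
    unfolding x S K_def prod_odd_mult odd_split even_split by (simp add: mult_ac)
qed

lemma xfac_Sfac_odd:
  assumes n: "4 < n" "even n" and m: "odd m" "1 \<le> m" "m \<le> n"
  shows "xfac n A m * Sfac n A m = K * D ({1..n}-{m})"
proof -
  have mn: "m + 1 \<le> n" using n m by presburger
  let ?T = "prod_odd (\<lambda>l. \<Prod>k\<in>{1..l-1}-{m}. hS A k l (l+1)) (m+2) (n-1)"
  let ?H = "prod_odd (\<lambda>k. hS A k (k+1) (m-1) * hS A k (k+1) (m+1)) 1 (m-4)"
  have T: "D ({1..m+1}-{m}) * ?T
      = D ({1..n}-{m}) * prod_odd (\<lambda>l. U l ^ nat (l-3) * \<rho> ^ nat (l-2)) (m+2) (n-1)"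
    using prod_odd_triangles[of "m+2" m n] n m mn by (simp add: add.commute)
  have "Sfac n A m = (hS A (m-2) (m-1) (m+1) * D {1..m-2} * ?H) * ?T
      * prod_even (\<lambda>l. U l ^ nat (l-2) * \<rho> ^ nat (l-1)) 2 (m-3)"
    unfolding Sfac_odd[OF m(1,2)] using prod_even_triangles[of "m-1"] m by (simp add: mult_ac)
  also have "\<dots> = (D ({1..m+1}-{m}) * ?T) * prod_odd (\<lambda>k. (U k)\<^sup>2) 1 (m-4) * \<rho> ^ nat (m-2)
      * prod_even (\<lambda>l. U l ^ nat (l-2) * \<rho> ^ nat (l-1)) 2 (m-3)"
    unfolding triangles_around_odd[OF m(1,2) mn] by (simp add: mult_ac)
  also have "prod_even (\<lambda>l. U l ^ nat (l-2) * \<rho> ^ nat (l-1)) 2 (m-3)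
      = prod_even (\<lambda>l. U l ^ nat (l-2)) 0 (m-3) * prod_odd (\<lambda>l. \<rho> ^ nat (l-2)) 1 (m-2)"
    unfolding prod_even_mult prod_even_power_shift
    by (subst prod_even_extend[of 0 2]) auto
  finally have S: "Sfac n A m
      = (D ({1..n}-{m}) * prod_odd (\<lambda>l. U l ^ nat (l-3) * \<rho> ^ nat (l-2)) (m+2) (n-1))
      * prod_odd (\<lambda>k. (U k)\<^sup>2) 1 (m-4) * \<rho> ^ nat (m-2)
      * (prod_even (\<lambda>l. U l ^ nat (l-2)) 0 (m-3) * prod_odd (\<lambda>l. \<rho> ^ nat (l-2)) 1 (m-2))"
    unfolding T .
  \<comment> \<open>The power of \<open>\<rho>\<close> from the triangles around \<open>m\<close> is
    exactly the term at \<open>l = m\<close>.\<close>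
  have rho: "prod_odd (\<lambda>l. \<rho> ^ nat (l-2)) 1 m = prod_odd (\<lambda>l. \<rho> ^ nat (l-2)) 1 (m-2) * \<rho> ^ nat (m-2)"
    using m by (intro prod_odd_step) auto
  have odd_split: "prod_odd f 1 (n-1) = prod_odd f 1 m * prod_odd f (m+2) (n-1)" for f
    using prod_odd_split[of 1 m "n-1" f] prod_odd_start_even[of "m+1" f "n-1"] m mn by (simp add: add.assoc)
  have even_split: "prod_even f 0 (n-2) = prod_even f 0 (m-3) * prod_even f (m-1) (n-2)" for f
  proof -
    \<comment> \<open>Starting at -1 covers \<open>m = 1\<close>, where \<open>m - 3\<close> is -2
      and a split from 0 would violate the range condition.\<close>
    have "prod_even f (-1) (n-2) = prod_even f (-1) (m-3) * prod_even f (m-3+1) (n-2)"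
      using m mn by (intro prod_even_split) auto
    moreover have "prod_even f (m-3+1) (n-2) = prod_even f (m-1) (n-2)"
      using prod_even_start_odd[of "m-2" f "n-2"] m by simp
    moreover have "prod_even f (-1) b = prod_even f 0 b" for b
      using prod_even_start_odd[of "-1" f b] by simp
    ultimately show ?thesis by simp
  qed
  have "xfac n A m * Sfac n A m = (xfac n A m * prod_odd (\<lambda>k. (U k)\<^sup>2) 1 (m-4))
      * D ({1..n}-{m}) * prod_odd (\<lambda>l. U l ^ nat (l-3) * \<rho> ^ nat (l-2)) (m+2) (n-1)
      * prod_even (\<lambda>l. U l ^ nat (l-2)) 0 (m-3) * prod_odd (\<lambda>l. \<rho> ^ nat (l-2)) 1 m"
    unfolding S rho by (simp add: mult_ac)
  then show ?thesis
    unfolding xfac_odd[OF n m] K_def prod_odd_mult odd_split even_split by (simp add: mult_ac)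
qed

end

section \<open>Points on a circle\<close>

lemma cos_diff_cos_sin_half:
  fixes x y :: real
  shows "cos y - cos x = - 2 * sin ((y + x) / 2) * sin ((y - x) / 2)"
proof -
  have "(x - y) / 2 = - ((y - x) / 2)" by (simp add: field_simps)
  then have "sin ((x - y) / 2) = - sin ((y - x) / 2)" by (simp only: sin_minus)
  then show ?thesis unfolding cos_diff_cos by simp
qed

lemma hx_circle:
  assumes "A p = (u + r * cos a, v + r * sin a)" "A q = (u + r * cos b, v + r * sin b)" "1 \<le> p" "1 \<le> q"
  shows "hx A p q = (2 * r * sin ((b - a) / 2))\<^sup>2"
proof -
  have "fst (A q) - fst (A p) = r * (cos b - cos a)" "snd (A q) - snd (A p) = r * (sin b - sin a)"
    using assms by (simp_all add: algebra_simps)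
  then have "hx A p q = r\<^sup>2 * ((cos b - cos a)\<^sup>2 + (sin b - sin a)\<^sup>2)"
    using assms(3,4) by (simp only: hx_def power_mult_distrib distrib_left) simp
  also have "\<dots> = (2 * r * sin ((b - a) / 2))\<^sup>2 * ((sin ((b + a) / 2))\<^sup>2 + (cos ((b + a) / 2))\<^sup>2)"
    unfolding cos_diff_cos_sin_half sin_diff_sin by algebra
  finally show ?thesis by simp
qed

text \<open>The chord vectors from \<open>A p\<close> are \<open>2 * r * sin ((b - a) / 2)\<close>
  and \<open>2 * r * sin ((c - a) / 2)\<close> times unit vectors. These enclose the inscribed angle
  \<open>(c - b) / 2\<close>, whose sine is the third factor.\<close>

lemma hS_circle:
  assumes "A p = (u + r * cos a, v + r * sin a)" "A q = (u + r * cos b, v + r * sin b)"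
    "A s = (u + r * cos c, v + r * sin c)" "1 \<le> p" "1 \<le> q" "1 \<le> s" "r \<noteq> 0"
  shows "hS A p q s
    = 1 / r * ((2 * r * sin ((b - a) / 2)) * (2 * r * sin ((c - a) / 2)) * (2 * r * sin ((c - b) / 2)))"
proof -
  have "(c - b) / 2 = (c + a) / 2 - (b + a) / 2" by (simp add: field_simps)
  then have scb: "sin ((c - b) / 2)
      = sin ((c + a) / 2) * cos ((b + a) / 2) - cos ((c + a) / 2) * sin ((b + a) / 2)"
    by (simp only: sin_diff)
  have "hS A p q s = 2 * r\<^sup>2 * ((cos b - cos a) * (sin c - sin a) - (sin b - sin a) * (cos c - cos a))"
    using assms by (simp add: hS_def power2_eq_square algebra_simps)
  also have "\<dots> = 2 * r\<^sup>2 * (4 * sin ((b - a) / 2) * sin ((c - a) / 2) * sin ((c - b) / 2))"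
    unfolding cos_diff_cos_sin_half sin_diff_sin scb by (simp add: algebra_simps)
  also have "\<dots> = 1 / r * ((2 * r * sin ((b - a) / 2)) * (2 * r * sin ((c - a) / 2)) * (2 * r * sin ((c - b) / 2)))"
    using assms(7) by (simp add: power2_eq_square)
  finally show ?thesis .
qed

lemma increasing_steps_imp_less:
  fixes f :: "int \<Rightarrow> real"
  assumes "\<And>i. i \<in> {1..n-1} \<Longrightarrow> f i < f (i+1)" "1 \<le> p" "p < q" "q \<le> n"
  shows "f p < f q"
  using assms(3,4)
proof (induction q rule: int_gr_induct)
  case base
  then show ?case using assms(1)[of p] assms(2) by simp
next
  case (step i)
  then have "f p < f i" "f i < f (i+1)" using assms(1)[of i] assms(2) by auto
  then show ?case by simp
qed

theorem theorem3p1: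
  fixes n :: int and A :: "int \<Rightarrow> real \<times> real"
  assumes "n > 4" and "even n" and "cyclic_anticlockwise n A"
  shows "(\<Sum>m\<in>{1..n}. (-1::real) ^ nat (m+1) * xfac n A m * Sfac n A m) = 0"
proof -
  obtain c r \<theta> where r: "r > 0"
    and A: "\<And>i. i \<in> {1..n} \<Longrightarrow> A i = (fst c + r * cos (\<theta> i), snd c + r * sin (\<theta> i))"
    and inc: "\<And>i. i \<in> {1..n-1} \<Longrightarrow> \<theta> i < \<theta> (i+1)" and wrap: "\<theta> n < \<theta> 1 + 2 * pi"
    using assms(3) unfolding cyclic_anticlockwise_def by blast
  define d where "d = (\<lambda>p q. 2 * r * sin ((\<theta> q - \<theta> p) / 2))"
  interpret chords n A d "1 / r"
  proof
    show "hx A p q = (d p q)\<^sup>2" if "p \<in> {1..n}" "q \<in> {1..n}" for p q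
      unfolding d_def using that by (intro hx_circle[OF A A]) auto
    show "hS A p q s = 1 / r * (d p q * d p s * d q s)"
      if "p \<in> {1..n}" "q \<in> {1..n}" "s \<in> {1..n}" for p q s
      unfolding d_def using that r by (intro hS_circle[OF A A A]) auto
  qed
  have less: "\<theta> p < \<theta> q" if "1 \<le> p" "p < q" "q \<le> n" for p q
    using increasing_steps_imp_less[where f=\<theta> and n=n, OF inc that] .
  have pos: "0 < sin ((\<theta> q - \<theta> p) / 2)" if "1 \<le> p" "p < q" "q \<le> n" for p q
  proof (rule sin_gt_zero)
    \<comment> \<open>All angles lie within less than one full turn, so half of any difference stays
      below \<open>pi\<close>.\<close>
    have "\<theta> 1 \<le> \<theta> p" "\<theta> q \<le> \<theta> n"
      using less[of 1 p] less[of q n] that by (cases "p = 1"; cases "q = n"; simp)+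
    then show "(\<theta> q - \<theta> p) / 2 < pi" using wrap by simp
    show "0 < (\<theta> q - \<theta> p) / 2" using less[OF that] by simp
  qed
  have "d p q \<noteq> 0" if "p \<in> {1..n}" "q \<in> {1..n}" "p \<noteq> q" for p q
  proof -
    have "sin ((\<theta> q - \<theta> p) / 2) = - sin ((\<theta> p - \<theta> q) / 2)"
      by (simp add: minus_divide_left flip: sin_minus)
    then show ?thesis
      using pos[of p q] pos[of q p] that r by (cases p q rule: linorder_cases) (auto simp: d_def)
  qed
  then have alternating: "(\<Sum>m\<in>{1..n}. (-1) ^ nat (m+1) * D ({1..n}-{m})) = 0"
    unfolding d_def using assms(1,2) by (intro alternating_chordprod_sum_eq_0) auto
  have "(-1::real) ^ nat (m+1) * xfac n A m * Sfac n A m = K * ((-1) ^ nat (m+1) * D ({1..n}-{m}))"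
    if "m \<in> {1..n}" for m
    using xfac_Sfac_even[of m] xfac_Sfac_odd[of m] assms(1,2) that by (cases "even m") (simp_all add: mult_ac)
  then have "(\<Sum>m\<in>{1..n}. (-1::real) ^ nat (m+1) * xfac n A m * Sfac n A m)
      = K * (\<Sum>m\<in>{1..n}. (-1) ^ nat (m+1) * D ({1..n}-{m}))"
    unfolding sum_distrib_left by (rule sum.cong[OF refl])
  then show ?thesis
    unfolding alternating by simp
qed

end
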